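(* Let $k\ge 1$ and let $F=\bigcup_{i=1}^{k}S_{d_i}$ be a star forest with $d_1\ge d_2\ge\cdots\ge d_k\ge 1$. Let $m\ge k-1$ be a positive integer. For $n$ sufficiently large compared to $m$ and $d_1,\dots,d_k$ (i.e. for all $n\ge n_0(m,d_1,\dots,d_k)$), $$\mathrm{ex}(m,n;F)=(k-1)\,n+(d_k-1)(m-k+1).$$ Moreover, the unique extremal graph is $\mathcal{B}(m,n;k)$; that is, every $F$-free bipartite graph $G=(A,B;E)$ with $|A|=m$, $|B|=n$ and $e(G)=\mathrm{ex}(m,n;F)$ is of the form $\mathcal{B}(m,n;k)$.
   Context: All graphs are finite, simple and undirected, and $e(G)$ denotes the number of edges of $G$. For a graph $H$ and positive integers $m\le n$, $\mathrm{ex}(m,n;H)$ is the maximum number of edges in an $H$-free bipartite graph $G=(A,B;E)$ with parts $A,B$ of sizes $|A|=m$ and $|B|=n$. Here "$H$-free" means that $G$ contains no (not necessarily induced) subgraph isomorphic to $H$; a copy of $H$ may be placed in $G$ in any way with respect to the parts $A,B$. $S_d$ denotes the star with one center and $d$ leaves, and $\bigcup_{i=1}^k S_{d_i}$ is the vertex-disjoint union of the stars $S_{d_1},\dots,S_{d_k}$. The graph $\mathcal{B}(m,n;k)$ is the bipartite graph with parts $A,B$, $|A|=m$, $|B|=n$, obtained by taking $k-1$ vertices of $A$ each adjacent to all of $B$, and letting each of the remaining $m-k+1$ vertices of $A$ have degree exactly $d_k-1$ into $B$. *)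

theory Defs
  imports Main
begin

record 'a graph =
  verts :: "'a set"
  edges :: "'a set set"

definition simple_graph :: "'a graph \<Rightarrow> bool" where
  "simple_graph G \<longleftrightarrow> finite (verts G) \<and> (\<forall>e\<in>edges G. e \<subseteq> verts G \<and> card e = 2)"

abbreviation num_edges :: "'a graph \<Rightarrow> nat" where
  "num_edges G \<equiv> card (edges G)"

definition neighbours :: "'a graph \<Rightarrow> 'a \<Rightarrow> 'a set" where
  "neighbours G v = {w \<in> verts G. {v, w} \<in> edges G}"

definition degree :: "'a graph \<Rightarrow> 'a \<Rightarrow> nat" where
  "degree G v = card (neighbours G v)"

definition subgraph :: "'a graph \<Rightarrow> 'a graph \<Rightarrow> bool" where
  "subgraph G' G \<longleftrightarrow> simple_graph G' \<and> verts G' \<subseteq> verts G \<and> edges G' \<subseteq> edges G"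

definition isomorphic :: "'a graph \<Rightarrow> 'b graph \<Rightarrow> bool" where
  "isomorphic G H \<longleftrightarrow> (\<exists>f. bij_betw f (verts G) (verts H) \<and>
     (\<forall>u\<in>verts G. \<forall>v\<in>verts G. {u, v} \<in> edges G \<longleftrightarrow> {f u, f v} \<in> edges H))"

definition graph_free :: "'b graph \<Rightarrow> 'a graph \<Rightarrow> bool" where
  "graph_free H G \<longleftrightarrow> \<not> (\<exists>G'. subgraph G' G \<and> isomorphic G' H)"

definition bipartite_graph :: "'a graph \<Rightarrow> 'a set \<Rightarrow> 'a set \<Rightarrow> bool" where
  "bipartite_graph G A B \<longleftrightarrow> simple_graph G \<and> verts G = A \<union> B \<and> A \<inter> B = {} \<and>
     (\<forall>e\<in>edges G. \<exists>a\<in>A. \<exists>b\<in>B. e = {a, b})"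

text \<open>
  Every finite graph has a copy with natural numbers as vertices, so letting the host graphs
  range over \<^typ>\<open>nat graph\<close> loses nothing. The set of edge counts is bounded by
  \<open>m * n\<close>; it is empty only if every such host graph contains \<open>H\<close>, in which
  case the value is unspecified.
\<close>
definition ex_bip :: "nat \<Rightarrow> nat \<Rightarrow> 'b graph \<Rightarrow> nat" where
  "ex_bip m n H = Max {num_edges G | (G :: nat graph) A B.
     bipartite_graph G A B \<and> card A = m \<and> card B = n \<and> graph_free H G}"

definition star :: "nat \<Rightarrow> nat graph" where
  "star d = \<lparr>verts = {0..d}, edges = {{0, j} | j. j \<in> {1..d}}\<rparr>"

definition disjoint_union :: "'i set \<Rightarrow> ('i \<Rightarrow> 'a graph) \<Rightarrow> ('i \<times> 'a) graph" where
  "disjoint_union I G = \<lparr>verts = (SIGMA i:I. verts (G i)),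
     edges = {Pair i ` e | i e. i \<in> I \<and> e \<in> edges (G i)}\<rparr>"

definition star_forest :: "nat \<Rightarrow> (nat \<Rightarrow> nat) \<Rightarrow> (nat \<times> nat) graph" where
  "star_forest k d = disjoint_union {1..k} (\<lambda>i. star (d i))"

text \<open>
  The description of \<open>\<B>(m,n;k)\<close> does not prescribe how the neighbourhoods of the low-degree
  vertices overlap, so it is a property of a bipartite graph with given parts rather than a single
  graph. The last argument is \<open>d\<^sub>k\<close>; the subtractions are meant for \<open>k \<ge> 1\<close>
  and \<open>d\<^sub>k \<ge> 1\<close>.
\<close>
definition is_B_graph :: "'a graph \<Rightarrow> 'a set \<Rightarrow> 'a set \<Rightarrow> nat \<Rightarrow> nat \<Rightarrow> nat \<Rightarrow> nat \<Rightarrow> bool" where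
  "is_B_graph G A B m n k dk \<longleftrightarrow> bipartite_graph G A B \<and> card A = m \<and> card B = n \<and>
     (\<exists>A\<^sub>0\<subseteq>A. card A\<^sub>0 = k - 1 \<and>
        (\<forall>a\<in>A\<^sub>0. \<forall>b\<in>B. {a, b} \<in> edges G) \<and>
        (\<forall>a\<in>A - A\<^sub>0. degree G a = dk - 1))"

end

theory Submission imports Defs begin

text \<open>
  Put \<open>D = d\<^sub>1 + \<dots> + d\<^sub>k\<close>. A star forest can be built greedily with its
  centres in \<open>A\<close> as soon as \<open>k - 1\<close> vertices of \<open>A\<close> have degree at least
  \<open>D\<close> and a further one has degree at least \<open>d\<^sub>k\<close>. Hence an \<open>F\<close>-free graph has
  at most \<open>k - 1\<close> vertices of degree at least \<open>D\<close> in \<open>A\<close>; if it has at least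
  \<open>(k - 1) n\<close> edges and \<open>n > m D\<close>, it has exactly \<open>k - 1\<close> of them, and all other
  vertices of \<open>A\<close> have degree at most \<open>d\<^sub>k - 1\<close>. Conversely, if the
  neighbourhoods of the low-degree vertices of a graph \<open>\<B>(m,n;k)\<close> are chosen pairwise disjoint,
  every star of the forest has to use one of the \<open>k - 1\<close> vertices of full degree.
\<close>

section \<open>Subgraphs as injective homomorphisms\<close>

text \<open>The image of \<open>H\<close> under \<open>g\<close> is the required subgraph, with the
  inverse of \<open>g\<close> as isomorphism. Copies need not be induced, so \<open>g\<close> only
  has to preserve edges.\<close>

lemma not_graph_free_if_embedding:
  assumes H: "simple_graph H" and inj: "inj_on g (verts H)"
    and vs: "g ` verts H \<subseteq> verts G"
    and es: "\<And>e. e \<in> edges H \<Longrightarrow> g ` e \<in> edges G"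
  shows "\<not> graph_free H G"
proof -
  have fin: "finite (verts H)" and sub: "\<And>e. e \<in> edges H \<Longrightarrow> e \<subseteq> verts H \<and> card e = 2"
    using H by (auto simp: simple_graph_def)
  define G' where "G' = \<lparr>verts = g ` verts H, edges = image g ` edges H\<rparr>"
  have "simple_graph G'"
    unfolding simple_graph_def G'_def using fin sub
    by (auto simp: card_image inj_on_subset[OF inj] dest!: sub)
  then have "subgraph G' G"
    using vs es by (auto simp: subgraph_def G'_def)
  moreover have "isomorphic G' H"
    unfolding isomorphic_def
  proof (intro exI[of _ "inv_into (verts H) g"] conjI ballI)
    show "bij_betw (inv_into (verts H) g) (verts G') (verts H)"
      using inj by (simp add: G'_def bij_betw_inv_into inj_on_imp_bij_betw)
  next
    fix u v assume "u \<in> verts G'" "v \<in> verts G'"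
    then obtain x y where xy: "x \<in> verts H" "y \<in> verts H" "u = g x" "v = g y"
      by (auto simp: G'_def)
    \<comment> \<open>Since \<open>g\<close> is injective on vertices, its image map is injective on
      vertex sets; hence no non-edge of \<open>H\<close> is sent to an edge of
      \<open>G'\<close>.\<close>
    have "{x, y} = e" if "e \<in> edges H" "g ` {x, y} = g ` e" for e
      using inj_on_image_eq_iff[OF inj, of "{x, y}" e] sub[OF that(1)] that(2) xy by simp
    then have "g ` {x, y} \<in> image g ` edges H \<longleftrightarrow> {x, y} \<in> edges H"
      by blast
    then show "{u, v} \<in> edges G' \<longleftrightarrow>
        {inv_into (verts H) g u, inv_into (verts H) g v} \<in> edges H"
      using xy inj by (simp add: G'_def)
  qed
  ultimately show ?thesis by (auto simp: graph_free_def)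
qed

lemma embedding_if_not_graph_free:
  assumes "\<not> graph_free H G"
  obtains g where "inj_on g (verts H)" "g ` verts H \<subseteq> verts G"
    "\<And>u v. u \<in> verts H \<Longrightarrow> v \<in> verts H \<Longrightarrow> {u, v} \<in> edges H \<Longrightarrow> {g u, g v} \<in> edges G"
proof -
  obtain G' f where sub: "subgraph G' G" and bij: "bij_betw f (verts G') (verts H)"
    and iff: "\<And>u v. u \<in> verts G' \<Longrightarrow> v \<in> verts G' \<Longrightarrow>
      {u, v} \<in> edges G' \<longleftrightarrow> {f u, f v} \<in> edges H"
    using assms unfolding graph_free_def isomorphic_def by blast
  define g where "g = inv_into (verts G') f"
  have g: "bij_betw g (verts H) (verts G')"
    using bij by (simp add: g_def bij_betw_inv_into)
  show thesis
  proof (rule that[of g])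
    show "inj_on g (verts H)" using g by (rule bij_betw_imp_inj_on)
    show "g ` verts H \<subseteq> verts G"
      using g sub by (auto simp: bij_betw_def subgraph_def)
  next
    fix u v assume uv: "u \<in> verts H" "v \<in> verts H" "{u, v} \<in> edges H"
    have "f (g u) = u" "f (g v) = v"
      using uv bij by (auto simp: g_def bij_betw_inv_into_right)
    moreover have "g u \<in> verts G'" "g v \<in> verts G'"
      using uv g by (auto simp: bij_betw_def)
    ultimately have "{g u, g v} \<in> edges G'" using iff uv by metis
    then show "{g u, g v} \<in> edges G" using sub by (auto simp: subgraph_def)
  qed
qed

section \<open>Degrees in bipartite graphs\<close>

lemma neighbours_subset_right:
  assumes "bipartite_graph G A B" "a \<in> A"
  shows "neighbours G a \<subseteq> B"
  using assms unfolding bipartite_graph_def neighbours_def by (fastforce simp: doubleton_eq_iff)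

lemma bipartite_graph_finite:
  assumes "bipartite_graph G A B"
  shows "finite A" "finite B"
  using assms by (auto simp: bipartite_graph_def simple_graph_def)

text \<open>Each edge has exactly one end in \<open>A\<close>, so edges correspond bijectively to
  pairs of a vertex of \<open>A\<close> and one of its neighbours; disjointness of \<open>A\<close>
  and \<open>B\<close> recovers the pair from the edge.\<close>

lemma num_edges_eq_sum_degree:
  assumes G: "bipartite_graph G A B"
  shows "num_edges G = (\<Sum>a\<in>A. degree G a)"
proof -
  have AB: "A \<inter> B = {}" "verts G = A \<union> B"
    "\<And>e. e \<in> edges G \<Longrightarrow> \<exists>a\<in>A. \<exists>b\<in>B. e = {a, b}"
    using G by (auto simp: bipartite_graph_def)
  have nb: "\<And>a. a \<in> A \<Longrightarrow> neighbours G a \<subseteq> B"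
    using neighbours_subset_right[OF G] .
  have fin: "\<And>a. a \<in> A \<Longrightarrow> finite (neighbours G a)"
    using nb bipartite_graph_finite[OF G] finite_subset by blast
  have eq: "edges G = (\<lambda>(a, b). {a, b}) ` (SIGMA a:A. neighbours G a)"
    using AB by (fastforce simp: neighbours_def)
  have "inj_on (\<lambda>(a, b). {a, b}) (SIGMA a:A. neighbours G a)"
    using nb AB by (fastforce simp: inj_on_def doubleton_eq_iff)
  then have "num_edges G = card (SIGMA a:A. neighbours G a)"
    unfolding eq by (rule card_image)
  also have "\<dots> = (\<Sum>a\<in>A. degree G a)"
    using fin bipartite_graph_finite[OF G] by (simp add: degree_def)
  finally show ?thesis .
qed

section \<open>Finding star forests\<close>

lemma simple_graph_star_forest: "simple_graph (star_forest k d)"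
  by (auto simp: simple_graph_def star_forest_def disjoint_union_def star_def card_insert_if)

text \<open>The sets are chosen one after another. \<open>X\<close> collects the vertices already
  taken and is kept general so that the induction can enlarge it.\<close>

lemma greedy_disjoint_subsets:
  assumes "finite I" "finite X" "\<And>i. i \<in> I \<Longrightarrow> finite (N i)"
    and "\<And>i. i \<in> I \<Longrightarrow> card X + sum d I \<le> card (N i)"
  shows "\<exists>L. \<forall>i\<in>I. L i \<subseteq> N i \<and> card (L i) = d i \<and> L i \<inter> X = {} \<and>
    (\<forall>j\<in>I. i \<noteq> j \<longrightarrow> L i \<inter> L j = {})"
  using assms
proof (induction I arbitrary: X rule: finite_induct)
  case empty
  then show ?case by simp
next
  case (insert j I)
  have "card (N j) - card X \<le> card (N j - X)"
    using insert.prems by (intro diff_card_le_card_Diff) auto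
  moreover have "card X + d j \<le> card (N j)"
    using insert.prems(3)[of j] insert.hyps by simp
  ultimately have "d j \<le> card (N j - X)" by linarith
  then obtain Y where Y: "Y \<subseteq> N j - X" "card Y = d j" "finite Y"
    by (rule obtain_subset_with_card_n)
  have card: "card (X \<union> Y) = card X + d j"
    using Y insert.prems by (subst card_Un_disjoint) auto
  \<comment> \<open>Passing to \<open>X \<union> Y\<close> adds \<open>d j\<close> to the size of
    the forbidden set, exactly what removing \<open>j\<close> takes off the sum, so the size
    condition survives.\<close>
  have "\<exists>L. \<forall>i\<in>I. L i \<subseteq> N i \<and> card (L i) = d i \<and> L i \<inter> (X \<union> Y) = {} \<and>
    (\<forall>j\<in>I. i \<noteq> j \<longrightarrow> L i \<inter> L j = {})"
  proof (rule insert.IH)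
    show "finite (X \<union> Y)" using Y insert.prems by auto
    show "\<And>i. i \<in> I \<Longrightarrow> finite (N i)" using insert.prems by auto
    fix i assume "i \<in> I"
    then show "card (X \<union> Y) + sum d I \<le> card (N i)"
      using insert.prems(3)[of i] insert.hyps card by simp
  qed
  then obtain L where L: "\<forall>i\<in>I. L i \<subseteq> N i \<and> card (L i) = d i \<and> L i \<inter> (X \<union> Y) = {} \<and>
    (\<forall>j\<in>I. i \<noteq> j \<longrightarrow> L i \<inter> L j = {})" ..
  show ?case
  proof (rule exI[of _ "L(j := Y)"], intro ballI)
    fix i assume "i \<in> insert j I"
    then show "(L(j := Y)) i \<subseteq> N i \<and> card ((L(j := Y)) i) = d i \<and> (L(j := Y)) i \<inter> X = {} \<and>
      (\<forall>j'\<in>insert j I. i \<noteq> j' \<longrightarrow> (L(j := Y)) i \<inter> (L(j := Y)) j' = {})"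
      using L Y insert.hyps by (cases "i = j") (simp_all, blast+)
  qed
qed

text \<open>Centres lie in \<open>A\<close> and leaves in \<open>B\<close>, so the only collisions
  to exclude are between two centres or between two leaves.\<close>

lemma star_forest_from_leaf_sets:
  fixes G :: "'a graph"
  assumes G: "bipartite_graph G A B"
    and c: "c ` {1..k} \<subseteq> A" "inj_on c {1..k}"
    and L: "\<And>i. i \<in> {1..k} \<Longrightarrow> L i \<subseteq> neighbours G (c i) \<and> card (L i) = d i"
    and disj: "\<And>i j. i \<in> {1..k} \<Longrightarrow> j \<in> {1..k} \<Longrightarrow> i \<noteq> j \<Longrightarrow> L i \<inter> L j = {}"
  shows "\<not> graph_free (star_forest k d) G"
proof -
  have LB: "L i \<subseteq> B" if "i \<in> {1..k}" for i
    using that L neighbours_subset_right[OF G, of "c i"] c by blast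
  have AB: "A \<inter> B = {}" "verts G = A \<union> B" using G by (auto simp: bipartite_graph_def)
  have "\<forall>i\<in>{1..k}. \<exists>h. bij_betw h {1..d i} (L i)"
  proof
    fix i assume i: "i \<in> {1..k}"
    then have "finite (L i)"
      using LB bipartite_graph_finite[OF G] finite_subset by blast
    then show "\<exists>h. bij_betw h {1..d i} (L i)"
      using ex_bij_betw_nat_finite_1[of "L i"] L[OF i] by auto
  qed
  then obtain h where h: "\<And>i. i \<in> {1..k} \<Longrightarrow> bij_betw (h i) {1..d i} (L i)"
    by metis
  then have hL: "h i j \<in> L i" if "i \<in> {1..k}" "j \<in> {1..d i}" for i j
    using bij_betwE[OF h[OF that(1)]] that(2) by blast
  \<comment> \<open>In \<open>star_forest\<close>, the pair \<open>(i, 0)\<close> is the centre of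
    the \<open>i\<close>-th star and \<open>(i, j)\<close> with \<open>j \<ge> 1\<close> is its
    \<open>j\<close>-th leaf.\<close>
  define g where "g = (\<lambda>(i, j). if j = 0 then c i else h i j)"
  have V: "verts (star_forest k d) = (SIGMA i:{1..k}. {0..d i})"
    by (simp add: star_forest_def disjoint_union_def star_def)
  have ch: "c i \<noteq> h i' j" if "i \<in> {1..k}" "i' \<in> {1..k}" "j \<in> {1..d i'}" for i i' j
  proof -
    have "c i \<in> A" using that(1) c(1) by blast
    moreover have "h i' j \<in> B" using subsetD[OF LB hL] that by simp
    ultimately show ?thesis using AB(1) by auto
  qed
  have hh: "i = i' \<and> j = j'"
    if "i \<in> {1..k}" "i' \<in> {1..k}" "j \<in> {1..d i}" "j' \<in> {1..d i'}" "h i j = h i' j'" for i i' j j'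
  proof -
    have "h i j \<in> L i \<inter> L i'" using hL[OF that(1,3)] hL[OF that(2,4)] that(5) by simp
    then have "i = i'" using disj[OF that(1,2)] by blast
    moreover have "inj_on (h i) {1..d i}" using h[OF that(1)] by (rule bij_betw_imp_inj_on)
    ultimately show ?thesis using that(3-5) by (simp only: inj_on_eq_iff)
  qed
  show ?thesis
  proof (rule not_graph_free_if_embedding[OF simple_graph_star_forest, of g])
    show "inj_on g (verts (star_forest k d))"
      unfolding V
    proof (rule inj_onI, clarify)
      fix i j i' j'
      assume *: "i \<in> {1..k}" "i' \<in> {1..k}" "j \<in> {0..d i}" "j' \<in> {0..d i'}"
        "g (i, j) = g (i', j')"
      consider "j = 0" "j' = 0" | "j = 0" "j' \<in> {1..d i'}" | "j \<in> {1..d i}" "j' = 0"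
        | "j \<in> {1..d i}" "j' \<in> {1..d i'}" using *(3,4) by (cases "j = 0"; cases "j' = 0") auto
      then show "i = i' \<and> j = j'"
      proof cases
        case 1
        then show ?thesis using * inj_onD[OF c(2), of i i'] by (simp add: g_def)
      next
        case 2
        then show ?thesis using * ch[of i i' j'] by (simp add: g_def)
      next
        case 3
        then show ?thesis using * ch[of i' i j] by (simp add: g_def)
      next
        case 4
        then show ?thesis using * hh[of i i' j j'] by (simp add: g_def)
      qed
    qed
    show "g ` verts (star_forest k d) \<subseteq> verts G"
    proof
      fix x assume "x \<in> g ` verts (star_forest k d)"
      then obtain i j where ij: "i \<in> {1..k}" "j \<le> d i" "x = g (i, j)"
        unfolding V by auto
      show "x \<in> verts G"
        using ij hL[of i j] LB[of i] c AB by (cases "j = 0") (auto simp: g_def)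
    qed
  next
    fix e assume "e \<in> edges (star_forest k d)"
    then obtain i j where ij: "i \<in> {1..k}" "j \<in> {1..d i}" "e = {(i, 0), (i, j)}"
      by (auto simp: star_forest_def disjoint_union_def star_def)
    then have "g ` e = {c i, h i j}" by (auto simp: g_def)
    moreover have "h i j \<in> neighbours G (c i)" using hL[of i j] L[of i] ij by auto
    ultimately show "g ` e \<in> edges G" by (simp add: neighbours_def)
  qed
qed

text \<open>The vertex \<open>a\<close> may have no neighbours to spare, so it takes its
  \<open>d k\<close> leaves first. Vertices of \<open>S\<close> have enough neighbours to avoid
  these leaves and those of each other.\<close>

lemma star_forest_from_degrees:
  assumes G: "bipartite_graph G A B" and k: "k \<ge> 1"
    and S: "S \<subseteq> A" "card S = k - 1"
    and big: "\<And>a. a \<in> S \<Longrightarrow> (\<Sum>i=1..k. d i) \<le> degree G a"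
    and a: "a \<in> A" "a \<notin> S" "d k \<le> degree G a"
  shows "\<not> graph_free (star_forest k d) G"
proof -
  have fin: "finite (neighbours G x)" if "x \<in> A" for x
    using that neighbours_subset_right[OF G] bipartite_graph_finite[OF G] finite_subset by blast
  have "finite S" using S bipartite_graph_finite[OF G] finite_subset by blast
  then obtain c0 where c0: "bij_betw c0 {1..k - 1} S"
    using ex_bij_betw_nat_finite_1[of S] S by auto
  define c where "c = c0(k := a)"
  have I: "{1..k} = insert k {1..k - 1}" using k by auto
  have ck: "c k = a" by (simp add: c_def)
  have cS: "c i \<in> S" if "i \<in> {1..k - 1}" for i
    using that c0 by (auto simp: c_def bij_betw_def)
  have cA: "c ` {1..k} \<subseteq> A"
  proof
    fix x assume "x \<in> c ` {1..k}"
    then have "x = a \<or> x \<in> S" unfolding I using cS ck by blast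
    then show "x \<in> A" using S a by blast
  qed
  have "inj_on c {1..k - 1}"
    using c0 by (auto simp: c_def bij_betw_def inj_on_def)
  then have inj: "inj_on c {1..k}"
    unfolding I using cS a(2) ck k by (auto simp del: atLeastAtMost_iff)
  \<comment> \<open>\<open>X\<close> is the leaf set of the star at \<open>a\<close>; it is the
    initial forbidden set for the greedy choice at the other centres.\<close>
  obtain X where X: "X \<subseteq> neighbours G a" "card X = d k" "finite X"
    using a(3) unfolding degree_def by (rule obtain_subset_with_card_n)
  have sum: "(\<Sum>i=1..k. d i) = d k + (\<Sum>i=1..k - 1. d i)"
    unfolding I using k by (subst sum.insert) auto
  have "\<exists>L. \<forall>i\<in>{1..k - 1}. L i \<subseteq> neighbours G (c i) \<and> card (L i) = d i \<and> L i \<inter> X = {} \<and>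
    (\<forall>j\<in>{1..k - 1}. i \<noteq> j \<longrightarrow> L i \<inter> L j = {})"
  proof (rule greedy_disjoint_subsets)
    fix i assume i: "i \<in> {1..k - 1}"
    then show "finite (neighbours G (c i))" using fin cS S by blast
    show "card X + sum d {1..k - 1} \<le> card (neighbours G (c i))"
      using big[OF cS[OF i]] sum X by (simp add: degree_def)
  qed (use X in auto)
  then obtain L where L: "\<forall>i\<in>{1..k - 1}. L i \<subseteq> neighbours G (c i) \<and> card (L i) = d i \<and>
    L i \<inter> X = {} \<and> (\<forall>j\<in>{1..k - 1}. i \<noteq> j \<longrightarrow> L i \<inter> L j = {})" ..
  have in_I: "i \<in> {1..k - 1}" if "i \<in> {1..k}" "i \<noteq> k" for i
    using that by auto
  show ?thesis
  proof (rule star_forest_from_leaf_sets[OF G cA inj, of "L(k := X)"])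
    fix i assume "i \<in> {1..k}"
    then show "(L(k := X)) i \<subseteq> neighbours G (c i) \<and> card ((L(k := X)) i) = d i"
      using L X ck in_I[of i] by (cases "i = k") simp_all
  next
    fix i j assume "i \<in> {1..k}" "j \<in> {1..k}" "i \<noteq> j"
    then show "(L(k := X)) i \<inter> (L(k := X)) j = {}"
      using L in_I[of i] in_I[of j] by (cases "i = k"; cases "j = k") (simp_all add: Int_commute)
  qed
qed

section \<open>The upper bound\<close>

text \<open>Upper bound and uniqueness come together: reaching the extremal value already forces the
  structure and hence equality, so the value cannot be exceeded.\<close>

lemma star_forest_free_imp_B_graph:
  assumes k: "k \<ge> 1" and dk: "d k \<ge> 1" and n: "n > m * (\<Sum>i=1..k. d i)"
    and G: "bipartite_graph G A B" "card A = m" "card B = n" "graph_free (star_forest k d) G"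
    and e: "num_edges G \<ge> (k - 1) * n + (d k - 1) * (m - (k - 1))"
  shows "is_B_graph G A B m n k (d k) \<and>
    num_edges G = (k - 1) * n + (d k - 1) * (m - (k - 1))"
proof -
  define D where "D = (\<Sum>i=1..k. d i)"
  have dkD: "d k \<le> D"
    unfolding D_def using k by (intro member_le_sum) auto
  have fin: "finite A" "finite B" using bipartite_graph_finite[OF G(1)] by auto
  have nb: "neighbours G a \<subseteq> B" if "a \<in> A" for a
    using neighbours_subset_right[OF G(1) that] .
  have deg_le: "degree G a \<le> n" if "a \<in> A" for a
    using card_mono[OF fin(2) nb[OF that]] G by (simp add: degree_def)
  define S where "S = {a \<in> A. D \<le> degree G a}"
  have S: "S \<subseteq> A" "finite S" using fin by (auto simp: S_def)
  have "card S \<le> k - 1"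
  proof (rule ccontr)
    assume "\<not> card S \<le> k - 1"
    then have "k - 1 < card S" by simp
    \<comment> \<open>With \<open>k\<close> vertices of degree at least \<open>D\<close>, take
      \<open>k - 1\<close> as large centres; a further one can be the last centre because
      \<open>d k \<le> D\<close>.\<close>
    then obtain T where T: "T \<subseteq> S" "card T = k - 1" "finite T"
      using obtain_subset_with_card_n[of "k - 1" S] by auto
    with \<open>k - 1 < card S\<close> obtain a where "a \<in> S" "a \<notin> T"
      by (metis less_irrefl subsetI subset_antisym)
    with T S have "\<not> graph_free (star_forest k d) G"
      using dkD by (intro star_forest_from_degrees[OF G(1) k, of T _ a])
        (auto simp: S_def D_def)
    then show False using G by simp
  qed
  have split: "num_edges G = (\<Sum>a\<in>S. degree G a) + (\<Sum>a\<in>A - S. degree G a)"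
    using sum.subset_diff[OF S(1) fin(1), of "degree G"] num_edges_eq_sum_degree[OF G(1)] by simp
  have sumS: "(\<Sum>a\<in>S. degree G a) \<le> card S * n"
    using sum_bounded_above[of S "degree G" n] deg_le S by auto
  have cardAS: "card (A - S) = m - card S"
    using card_Diff_subset[OF S(2,1)] G by simp
  have "card S = k - 1"
  proof (rule ccontr)
    assume "card S \<noteq> k - 1"
    then have lt: "Suc (card S) \<le> k - 1" using \<open>card S \<le> k - 1\<close> by simp
    have le_D: "degree G a \<le> D" if "a \<in> A - S" for a
      using that by (auto simp: S_def)
    have "(\<Sum>a\<in>A - S. degree G a) \<le> card (A - S) * D"
      using sum_bounded_above[of "A - S" "degree G" D] le_D by simp
    also have "\<dots> \<le> m * D" using cardAS by simp
    also have "\<dots> < n" using n by (simp add: D_def)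
    \<comment> \<open>The vertices of \<open>S\<close> contribute at most \<open>card S * n\<close>,
      all others together less than \<open>n\<close>. With fewer than \<open>k - 1\<close> vertices
      in \<open>S\<close> this stays below \<open>(k - 1) * n\<close>.\<close>
    finally have "num_edges G < Suc (card S) * n" using split sumS by simp
    also have "\<dots> \<le> (k - 1) * n" using lt by (rule mult_le_mono1)
    finally show False using e by simp
  qed
  \<comment> \<open>A vertex outside \<open>S\<close> of degree at least \<open>d k\<close> would
    serve as the last centre next to the \<open>k - 1\<close> vertices of \<open>S\<close>.\<close>
  have low: "degree G a \<le> d k - 1" if "a \<in> A - S" for a
  proof (rule ccontr)
    assume "\<not> degree G a \<le> d k - 1"
    then have "\<not> graph_free (star_forest k d) G"
      using that S \<open>card S = k - 1\<close>
      by (intro star_forest_from_degrees[OF G(1) k, of S _ a]) (auto simp: S_def D_def)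
    then show False using G by simp
  qed
  have sumAS: "(\<Sum>a\<in>A - S. degree G a) \<le> (d k - 1) * (m - (k - 1))"
    using sum_bounded_above[of "A - S" "degree G" "d k - 1"] low cardAS \<open>card S = k - 1\<close>
    by (simp add: mult.commute)
  \<comment> \<open>By \<open>e\<close> the sum of the two partial sums is at least the sum of their
    upper bounds, so both bounds are attained, and then termwise.\<close>
  have eqS: "(\<Sum>a\<in>S. degree G a) = (\<Sum>a\<in>S. n)"
    and eqAS: "(\<Sum>a\<in>A - S. degree G a) = (\<Sum>a\<in>A - S. d k - 1)"
    using split sumS sumAS e cardAS \<open>card S = k - 1\<close> by (simp_all add: mult.commute)
  have degS: "degree G a = n" if "a \<in> S" for a
    using sum_mono_inv[OF eqS _ that S(2)] deg_le S by blast
  have degAS: "degree G a = d k - 1" if "a \<in> A - S" for a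
    using sum_mono_inv[OF eqAS _ that] low fin by blast
  have "{a, b} \<in> edges G" if "a \<in> S" "b \<in> B" for a b
  proof -
    have "neighbours G a = B"
      using card_subset_eq[OF fin(2) nb] degS that S G by (auto simp: degree_def)
    then show ?thesis using that by (auto simp: neighbours_def)
  qed
  then have "is_B_graph G A B m n k (d k)"
    unfolding is_B_graph_def using G S \<open>card S = k - 1\<close> degAS by blast
  moreover have "num_edges G = (k - 1) * n + (d k - 1) * (m - (k - 1))"
    using split sumS sumAS e \<open>card S = k - 1\<close> by simp
  ultimately show ?thesis by blast
qed

section \<open>The construction\<close>

lemma interval_block_unique:
  fixes q s :: nat
  assumes "q \<in> {a * s..<Suc a * s}"
  shows "q div s = a"
  using assms by (intro div_nat_eqI) (auto simp: mult.commute)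

text \<open>The low-degree vertices get disjoint blocks of \<open>B\<close>. With overlapping blocks
  a vertex of \<open>B\<close> could be the centre of a star whose leaves are low-degree vertices,
  and the graph might contain the forest.\<close>

lemma ex_star_forest_free:
  assumes k: "k \<ge> 1" "m \<ge> k - 1" and dk: "d k \<ge> 1" and n: "n \<ge> m * (d k - 1)"
    and mono: "\<And>i. i \<in> {1..k} \<Longrightarrow> d k \<le> d i"
  shows "\<exists>(G :: nat graph) A B. bipartite_graph G A B \<and> card A = m \<and> card B = n \<and>
    graph_free (star_forest k d) G \<and>
    num_edges G = (k - 1) * n + (d k - 1) * (m - (k - 1))"
proof -
  define s where "s = d k - 1"
  \<comment> \<open>Vertices below \<open>k - 1\<close> are joined to all of
    \<open>B = {m..<m + n}\<close>; any other \<open>a\<close> gets the \<open>a\<close>-th block of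
    length \<open>s\<close>. The blocks fit because \<open>n \<ge> m * s\<close>.\<close>
  define N where "N a = (if a < k - 1 then {m..<m + n} else {m + a * s..<m + Suc a * s})" for a
  define G where "G = \<lparr>verts = {0..<m} \<union> {m..<m + n},
    edges = {{a, b} | a b. a < m \<and> b \<in> N a}\<rparr>"
  have NB: "N a \<subseteq> {m..<m + n}" if "a < m" for a
  proof -
    have "Suc a * s \<le> m * s" using that by (intro mult_le_mono1) simp
    then have "m + Suc a * s \<le> m + n" using n by (simp add: s_def)
    then show ?thesis by (auto simp: N_def)
  qed
  have G: "bipartite_graph G {0..<m} {m..<m + n}"
    unfolding bipartite_graph_def simple_graph_def G_def
    using NB by (fastforce simp: card_insert_if)
  have edge: "{a, b} \<in> edges G \<longleftrightarrow> b \<in> N a" if "a < m" for a b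
  proof
    assume "{a, b} \<in> edges G"
    then obtain a' b' where "a' < m" "b' \<in> N a'" "{a, b} = {a', b'}" by (auto simp: G_def)
    then show "b \<in> N a" using NB[of a'] that by (auto simp: doubleton_eq_iff)
  qed (use that in \<open>auto simp: G_def\<close>)
  have nbr: "neighbours G a = N a" if "a < m" for a
    using edge[OF that] NB[OF that] by (auto simp: neighbours_def G_def)
  have "num_edges G = (\<Sum>a<m. card (N a))"
    using num_edges_eq_sum_degree[OF G] nbr by (simp add: degree_def atLeast0LessThan)
  also have "\<dots> = (\<Sum>a<k - 1. card (N a)) + (\<Sum>a=k - 1..<m. card (N a))"
    using sum.atLeastLessThan_concat[of 0 "k - 1" m "\<lambda>a. card (N a)"] k
    by (simp add: atLeast0LessThan)
  also have "\<dots> = (k - 1) * n + (d k - 1) * (m - (k - 1))"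
    by (simp add: N_def s_def mult.commute)
  finally have num: "num_edges G = (k - 1) * n + (d k - 1) * (m - (k - 1))" .
  have "graph_free (star_forest k d) G"
  proof (rule ccontr)
    assume "\<not> graph_free (star_forest k d) G"
    then obtain g where inj: "inj_on g (verts (star_forest k d))"
      and vs: "g ` verts (star_forest k d) \<subseteq> verts G"
      and es: "\<And>u v. u \<in> verts (star_forest k d) \<Longrightarrow> v \<in> verts (star_forest k d) \<Longrightarrow>
        {u, v} \<in> edges (star_forest k d) \<Longrightarrow> {g u, g v} \<in> edges G"
      using embedding_if_not_graph_free by blast
    have V: "verts (star_forest k d) = (SIGMA i:{1..k}. {0..d i})"
      by (simp add: star_forest_def disjoint_union_def star_def)
    have E: "{g (i, 0), g (i, j)} \<in> edges G" if "i \<in> {1..k}" "j \<in> {1..d i}" for i j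
    proof (rule es)
      have "{(i, 0), (i, j)} = Pair i ` {0, j}" by auto
      moreover have "{0, j} \<in> edges (star (d i))" using that by (auto simp: star_def)
      ultimately show "{(i, 0), (i, j)} \<in> edges (star_forest k d)"
        using that(1) unfolding star_forest_def disjoint_union_def graph.simps by blast
    qed (use that in \<open>auto simp: V\<close>)
    \<comment> \<open>Each embedded star must use one of the \<open>k - 1\<close> vertices of full
      degree, as its centre or as a leaf.\<close>
    have "\<exists>x\<in>{0..d i}. g (i, x) < k - 1" if i: "i \<in> {1..k}" for i
    proof (rule ccontr)
      assume "\<not> ?thesis"
      then have high: "k - 1 \<le> g (i, x)" if "x \<le> d i" for x using that by force
      have di: "d k \<le> d i" using mono i by blast
      have inj_i: "inj_on (\<lambda>j. g (i, j)) {1..d i}"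
      proof (rule inj_onI)
        fix j j' assume "j \<in> {1..d i}" "j' \<in> {1..d i}" "g (i, j) = g (i, j')"
        then show "j = j'" using inj_onD[OF inj, of "(i, j)" "(i, j')"] i by (simp add: V)
      qed
      show False
      proof (cases "g (i, 0) < m")
        case True
        \<comment> \<open>A centre in \<open>A\<close> outside the full vertices has only
          \<open>s = d k - 1\<close> neighbours, fewer than the \<open>d i\<close> leaves.\<close>
        have "(\<lambda>j. g (i, j)) ` {1..d i} \<subseteq> N (g (i, 0))"
          using E[OF i] edge[OF True] by auto
        then have "card {1..d i} \<le> card (N (g (i, 0)))"
          by (rule card_inj_on_le[OF inj_i]) (simp add: N_def)
        moreover have "card (N (g (i, 0))) = s" using high[of 0] by (simp add: N_def)
        ultimately show False using di dk by (simp add: s_def)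
      next
        case False
        \<comment> \<open>The centre is now in \<open>B\<close>, so each leaf is a low-degree vertex
          whose block contains the centre. Division by \<open>s\<close> identifies this block, so
          every leaf is the same vertex.\<close>
        have leaf: "g (i, j) = (g (i, 0) - m) div s \<and> s > 0" if j: "j \<in> {1..d i}" for j
        proof -
          obtain a b where ab: "a < m" "b \<in> N a" "{g (i, 0), g (i, j)} = {a, b}"
            using E[OF i j] by (auto simp: G_def)
          then have "a = g (i, j)" "b = g (i, 0)"
            using False by (auto simp: doubleton_eq_iff)
          moreover have "b \<in> {m + a * s..<m + Suc a * s}"
            using ab high[of j] j \<open>a = g (i, j)\<close> by (simp add: N_def)
          then have "b - m \<in> {a * s..<Suc a * s}" by auto
          then have "(b - m) div s = a" by (rule interval_block_unique)
          moreover have "s > 0"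
            using \<open>b - m \<in> {a * s..<Suc a * s}\<close> by (cases s) auto
          ultimately show ?thesis by simp
        qed
        \<comment> \<open>The star has at least one leaf, so blocks are nonempty and
          \<open>d k \<ge> 2\<close>. The star then has a second leaf, which would coincide with the
          first.\<close>
        have "1 \<le> d i" using di dk by simp
        then have "s > 0" using leaf[of 1] by simp
        then have "2 \<le> d i" using di by (simp add: s_def)
        then have "g (i, 1) = g (i, 2)" using leaf[of 1] leaf[of 2] by simp
        then show False using inj_onD[OF inj_i, of 1 2] \<open>2 \<le> d i\<close> by simp
      qed
    qed
    then obtain x where x: "\<And>i. i \<in> {1..k} \<Longrightarrow> x i \<le> d i \<and> g (i, x i) < k - 1"
      by (metis atLeastAtMost_iff)
    \<comment> \<open>Pigeonhole: disjoint stars use different full vertices, so \<open>k\<close>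
      stars cannot share \<open>k - 1\<close> of them.\<close>
    have "inj_on (\<lambda>i. g (i, x i)) {1..k}"
    proof (rule inj_onI)
      fix i j assume "i \<in> {1..k}" "j \<in> {1..k}" "g (i, x i) = g (j, x j)"
      then show "i = j" using inj_onD[OF inj, of "(i, x i)" "(j, x j)"] x by (auto simp: V)
    qed
    moreover have "(\<lambda>i. g (i, x i)) ` {1..k} \<subseteq> {..<k - 1}" using x by auto
    ultimately have "card {1..k} \<le> card {..<k - 1}" by (intro card_inj_on_le) auto
    then show False using k by simp
  qed
  then show ?thesis
    using G num by (intro exI[of _ G] exI[of _ "{0..<m}"] exI[of _ "{m..<m + n}"]) simp
qed

section \<open>The value of the extremal number and uniqueness\<close>

lemma ex_bip_star_forest:
  assumes k: "k \<ge> 1" "m \<ge> k - 1" and dk: "d k \<ge> 1" and n: "n > m * (\<Sum>i=1..k. d i)"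
    and mono: "\<And>i. i \<in> {1..k} \<Longrightarrow> d k \<le> d i"
  shows "ex_bip m n (star_forest k d) = (k - 1) * n + (d k - 1) * (m - (k - 1))"
    (is "_ = ?v")
proof -
  have "d k \<le> (\<Sum>i=1..k. d i)"
    using k by (intro member_le_sum) auto
  then have "m * (d k - 1) \<le> m * (\<Sum>i=1..k. d i)" by (intro mult_le_mono2) simp
  then have n': "m * (d k - 1) \<le> n" using n by linarith
  define Q where "Q = {num_edges G | (G :: nat graph) A B.
     bipartite_graph G A B \<and> card A = m \<and> card B = n \<and> graph_free (star_forest k d) G}"
  have ub: "q \<le> ?v" if q: "q \<in> Q" for q
  proof (rule ccontr)
    assume "\<not> q \<le> ?v"
    then have "?v < q" by simp
    obtain G :: "nat graph" and A B where "q = num_edges G" "bipartite_graph G A B"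
      "card A = m" "card B = n" "graph_free (star_forest k d) G"
      using q unfolding Q_def by blast
    then have "q = ?v"
      using star_forest_free_imp_B_graph[OF k(1) dk n, of G A B] \<open>?v < q\<close> by simp
    then show False using \<open>?v < q\<close> by simp
  qed
  have "?v \<in> Q"
  proof -
    have "\<exists>(G :: nat graph) A B. bipartite_graph G A B \<and> card A = m \<and> card B = n \<and>
        graph_free (star_forest k d) G \<and> num_edges G = ?v"
      using k dk n' mono by (intro ex_star_forest_free) auto
    then obtain G :: "nat graph" and A B where "bipartite_graph G A B" "card A = m" "card B = n"
      "graph_free (star_forest k d) G" "num_edges G = ?v" by blast
    then show ?thesis unfolding Q_def by (intro CollectI exI[of _ G] exI[of _ A] exI[of _ B]) simp
  qed
  \<comment> \<open>The uniform bound on edge counts also supplies the finiteness that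
    \<open>Max\<close> requires.\<close>
  moreover have "finite Q" using ub finite_nat_set_iff_bounded_le by blast
  ultimately have "Max Q = ?v" using ub by (intro Max_eqI) auto
  then show ?thesis by (simp add: ex_bip_def Q_def)
qed

theorem theorem1p6:
  fixes k m :: nat and d :: "nat \<Rightarrow> nat"
  assumes "k \<ge> 1"
    and "\<And>i j. 1 \<le> i \<Longrightarrow> i \<le> j \<Longrightarrow> j \<le> k \<Longrightarrow> d j \<le> d i"
    and "d k \<ge> 1"
    and "m \<ge> 1" and "m \<ge> k - 1"
  shows "\<exists>n\<^sub>0. \<forall>n\<ge>n\<^sub>0.
    int (ex_bip m n (star_forest k d)) =
      (int k - 1) * int n + (int (d k) - 1) * (int m - int k + 1) \<and>
    (\<forall>(G :: 'a graph) A B.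
       bipartite_graph G A B \<and> card A = m \<and> card B = n \<and> graph_free (star_forest k d) G \<and>
       num_edges G = ex_bip m n (star_forest k d)
       \<longrightarrow> is_B_graph G A B m n k (d k))"
proof (intro exI[of _ "Suc (m * (\<Sum>i=1..k. d i))"] allI impI conjI)
  fix n assume "Suc (m * (\<Sum>i=1..k. d i)) \<le> n"
  then have n: "n > m * (\<Sum>i=1..k. d i)" by simp
  have ex: "ex_bip m n (star_forest k d) = (k - 1) * n + (d k - 1) * (m - (k - 1))"
    using assms n by (intro ex_bip_star_forest) auto
  show "int (ex_bip m n (star_forest k d)) =
      (int k - 1) * int n + (int (d k) - 1) * (int m - int k + 1)"
    \<comment> \<open>Since \<open>k \<ge> 1\<close>, \<open>d k \<ge> 1\<close> and
      \<open>m \<ge> k - 1\<close>, none of the natural-number subtractions truncates.\<close>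
    unfolding ex of_nat_add of_nat_mult using assms by (simp add: of_nat_diff)
  \<comment> \<open>\<open>ex_bip\<close> ranges over graphs on \<open>nat\<close>, while
    \<open>G\<close> has an arbitrary vertex type; only the numerical value \<open>ex\<close> links
    the two.\<close>
  fix G :: "'a graph" and A B
  assume "bipartite_graph G A B \<and> card A = m \<and> card B = n \<and> graph_free (star_forest k d) G \<and>
       num_edges G = ex_bip m n (star_forest k d)"
  then show "is_B_graph G A B m n k (d k)"
    using star_forest_free_imp_B_graph[OF assms(1,3) n, of G A B] ex by simp
qed

end
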